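(* Let $(a,x)\in \mathcal{S}_{\mathrm{CPP}}$ and $\eta:=a-x$. Then \[ \kappa[\mathcal{S}_{\mathrm{CPP}}](a,x) = \Vert H_{\eta}^{-1} \Vert_{\mathcal{I}\to\mathcal{I}}, \] where $H_\eta = \mathbf{1}-S_\eta$ and the right-hand side is read as $+\infty$ if $H_\eta$ is not invertible. Moreover, if $(a,x) \in \mathcal{S}_{\mathrm{CPP}}\setminus\mathcal{W}_{\mathrm{CPP}}$, then $H_{\eta}$ is not invertible.
   Context: $\mathcal{I}\subset\mathbb{R}^n$ is an $m$-dimensional embedded smooth submanifold with the Riemannian metric inherited from the Euclidean inner product of $\mathbb{R}^n$. $\mathrm{T}_x\mathcal{I}$ is the tangent space and $\mathrm{N}_x\mathcal{I}=(\mathrm{T}_x\mathcal{I})^\perp\subset\mathbb{R}^n$ the normal space at $x$. $\mathrm{D}_pF$ denotes the derivative of a map $F$ at $p$. The critical point locus is $\mathcal{S}_{\mathrm{CPP}}=\{(a,x)\in\mathbb{R}^n\times\mathcal{I}\mid a-x\in\mathrm{N}_x\mathcal{I}\}$, an embedded submanifold of $\mathbb{R}^n\times\mathcal{I}$ of dimension $n$. Let $\Pi_{\mathbb{R}^n}:\mathcal{S}_{\mathrm{CPP}}\to\mathbb{R}^n$ and $\Pi_{\mathcal{I}}:\mathcal{S}_{\mathrm{CPP}}\to\mathcal{I}$ be the coordinate projections, and $\mathcal{W}_{\mathrm{CPP}}=\{(a,x)\in\mathcal{S}_{\mathrm{CPP}}\mid \mathrm{D}_{(a,x)}\Pi_{\mathbb{R}^n}\text{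 is invertible}\}$. The condition number is $\kappa[\mathcal{S}_{\mathrm{CPP}}](a,x)=\|(\mathrm{D}_{(a,x)}\Pi_{\mathcal{I}})(\mathrm{D}_{(a,x)}\Pi_{\mathbb{R}^n})^{-1}\|_{\mathbb{R}^n\to\mathcal{I}}$ if $\mathrm{D}_{(a,x)}\Pi_{\mathbb{R}^n}$ is invertible, and $+\infty$ otherwise. Here $\|A\|_{\mathcal{M}\to\mathcal{N}}=\sup_{t\neq0}\|A t\|_{\mathcal{N}}/\|t\|_{\mathcal{M}}$ is the spectral norm of a linear map between tangent spaces of Riemannian manifolds $\mathcal{M},\mathcal{N}$, with the norms induced by the metrics. For $\eta\in\mathrm{N}_x\mathcal{I}$, the Weingarten map (shape operator) $S_\eta:\mathrm{T}_x\mathcal{I}\to\mathrm{T}_x\mathcal{I}$ is the self-adjoint map with $\langle S_\eta(v),w\rangle=\langle \mathit{I\!I}_x(v,w),\eta\rangle$, where $\mathit{I\!I}_x(v,w)\in\mathrm{N}_x\mathcal{I}$ is the second fundamental form (the normal component of the Euclidean directional derivative along $v$ of a tangent vector field extending $w$). $\mathbf{1}$ is the identity of $\mathrm{T}_x\mathcal{I}$ and $H_\eta:=\mathbf{1}-S_\eta$; for $\eta=a-x$ this is the Riemannian Hessian at $x$ of the function $x'\mapsto\frac12\|x'-a\|^2$ on $\mathcal{I}$. *)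

theory Defs
  imports "HOL-Analysis.Analysis"
begin

section \<open>Smooth maps\<close>

text \<open>
  \<open>Ck_on k U f\<close> is \<open>k\<close>-fold continuous differentiability, expressed through iterated directional
  derivatives. It is meant for open \<open>U\<close> only: derivatives are taken in the whole space.
\<close>

primrec Ck_on ::
  "nat \<Rightarrow> 'a::euclidean_space set \<Rightarrow> ('a \<Rightarrow> 'b::euclidean_space) \<Rightarrow> bool" where
  "Ck_on 0 U f \<longleftrightarrow> continuous_on U f"
| "Ck_on (Suc k) U f \<longleftrightarrow>
     (\<forall>x\<in>U. f differentiable (at x)) \<and> (\<forall>v. Ck_on k U (\<lambda>x. frechet_derivative f (at x) v))"

definition smooth_on :: "'a::euclidean_space set \<Rightarrow> ('a \<Rightarrow> 'b::euclidean_space) \<Rightarrow> bool" where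
  "smooth_on U f \<longleftrightarrow> (\<forall>k. Ck_on k U f)"

section \<open>Embedded submanifolds of Euclidean space\<close>

text \<open>
  Slice charts: near each of its points, a diffeomorphism \<open>\<phi>\<close> between open sets of the ambient
  space straightens \<open>M\<close> to an \<open>m\<close>-dimensional linear subspace.
\<close>

definition embedded_submanifold :: "'a::euclidean_space set \<Rightarrow> nat \<Rightarrow> bool" where
  "embedded_submanifold M m \<longleftrightarrow>
     (\<forall>x\<in>M. \<exists>(U :: 'a set) (V :: 'a set) \<phi> \<psi> L.
        open U \<and> x \<in> U \<and> open V \<and>
        homeomorphism U V \<phi> \<psi> \<and> smooth_on U \<phi> \<and> smooth_on V \<psi> \<and>
        subspace L \<and> dim L = m \<and> \<phi> ` (U \<inter> M) = V \<inter> L)"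

definition smooth_curve_through ::
  "'a::euclidean_space set \<Rightarrow> 'a \<Rightarrow> 'a \<Rightarrow> (real \<Rightarrow> 'a) \<Rightarrow> bool" where
  "smooth_curve_through M p v c \<longleftrightarrow>
     (\<exists>e>0. smooth_on {-e<..<e} c \<and> c ` {-e<..<e} \<subseteq> M) \<and>
     c 0 = p \<and> (c has_vector_derivative v) (at 0)"

definition tangent_space :: "'a::euclidean_space set \<Rightarrow> 'a \<Rightarrow> 'a set" where
  "tangent_space M p = {v. \<exists>c. smooth_curve_through M p v c}"

definition normal_space :: "'a::euclidean_space set \<Rightarrow> 'a \<Rightarrow> 'a set" where
  "normal_space M p = (tangent_space M p)\<^sup>\<bottom>"

text \<open>
  The derivative at \<open>p\<close> of the restriction of \<open>F\<close> to \<open>M\<close>, as a map on \<open>tangent_space M p\<close>: it sends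
  the velocity of a curve \<open>c\<close> to the velocity of \<open>F \<circ> c\<close>. It is unspecified off the tangent space.
\<close>

definition mderiv ::
  "'a::euclidean_space set \<Rightarrow> ('a \<Rightarrow> 'b::euclidean_space) \<Rightarrow> 'a \<Rightarrow> 'a \<Rightarrow> 'b" where
  "mderiv M F p v =
     (THE w. \<forall>c. smooth_curve_through M p v c \<longrightarrow> ((F \<circ> c) has_vector_derivative w) (at 0))"

text \<open>
  The spectral norm of a linear map \<open>A\<close> defined on the subspace \<open>T\<close>. Values are taken in \<open>ennreal\<close>,
  where the supremum over the empty set, which occurs when \<open>T\<close> is zero-dimensional, is \<open>0\<close>.
\<close>

definition norm_on :: "'a::euclidean_space set \<Rightarrow> ('a \<Rightarrow> 'b::euclidean_space) \<Rightarrow> ennreal" where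
  "norm_on T A = (SUP t\<in>T - {0}. ennreal (norm (A t) / norm t))"

section \<open>The critical point locus and its condition number\<close>

definition S_CPP :: "'a::euclidean_space set \<Rightarrow> ('a \<times> 'a) set" where
  "S_CPP M = {(a, x). x \<in> M \<and> a - x \<in> normal_space M x}"

text \<open>
  For \<open>S \<subseteq> \<real>\<^sup>n \<times> M\<close> the coordinate projections are the restrictions of \<^const>\<open>fst\<close> and \<^const>\<open>snd\<close> to \<open>S\<close>.
\<close>

definition fst_deriv_invertible ::
  "('a::euclidean_space \<times> 'b::euclidean_space) set \<Rightarrow> 'a \<times> 'b \<Rightarrow> bool" where
  "fst_deriv_invertible S p \<longleftrightarrow>
     bij_betw (mderiv S fst p) (tangent_space S p) (tangent_space UNIV (fst p))"

definition W_CPP :: "'a::euclidean_space set \<Rightarrow> ('a \<times> 'a) set" where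
  "W_CPP M = {p \<in> S_CPP M. fst_deriv_invertible (S_CPP M) p}"

definition condition_number ::
  "('a::euclidean_space \<times> 'b::euclidean_space) set \<Rightarrow> 'a \<times> 'b \<Rightarrow> ennreal" where
  "condition_number S p =
     (if fst_deriv_invertible S p
      then norm_on (tangent_space UNIV (fst p))
             (mderiv S snd p \<circ> inv_into (tangent_space S p) (mderiv S fst p))
      else \<infinity>)"

section \<open>Second fundamental form and Weingarten map\<close>

text \<open>Tangent vector fields on \<open>M\<close> near \<open>x\<close>, given by a smooth extension to an open subset of the
  ambient space.\<close>

definition tangent_field_near ::
  "'a::euclidean_space set \<Rightarrow> 'a \<Rightarrow> ('a \<Rightarrow> 'a) \<Rightarrow> bool" where
  "tangent_field_near M x W \<longleftrightarrow>
     (\<exists>U. open U \<and> x \<in> U \<and> smooth_on U W \<and> (\<forall>y\<in>U \<inter> M. W y \<in> tangent_space M y))"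

text \<open>
  The normal component of the directional derivative along \<open>v\<close> of a tangent field \<open>W\<close> extending \<open>w\<close>;
  it does not depend on the choice of \<open>W\<close>.
\<close>

definition second_fundamental_form ::
  "'a::euclidean_space set \<Rightarrow> 'a \<Rightarrow> 'a \<Rightarrow> 'a \<Rightarrow> 'a" where
  "second_fundamental_form M x v w =
     (THE u. u \<in> normal_space M x \<and>
        (\<forall>W. tangent_field_near M x W \<and> W x = w \<longrightarrow>
           frechet_derivative W (at x) v - u \<in> tangent_space M x))"

definition weingarten :: "'a::euclidean_space set \<Rightarrow> 'a \<Rightarrow> 'a \<Rightarrow> 'a \<Rightarrow> 'a" where
  "weingarten M x \<eta> v =
     (THE s. s \<in> tangent_space M x \<and>
        (\<forall>w\<in>tangent_space M x. s \<bullet> w = second_fundamental_form M x v w \<bullet> \<eta>))"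

definition H_map :: "'a::euclidean_space set \<Rightarrow> 'a \<Rightarrow> 'a \<Rightarrow> 'a \<Rightarrow> 'a" where
  "H_map M x \<eta> v = v - weingarten M x \<eta> v"

definition H_invertible :: "'a::euclidean_space set \<Rightarrow> 'a \<Rightarrow> 'a \<Rightarrow> bool" where
  "H_invertible M x \<eta> \<longleftrightarrow> bij_betw (H_map M x \<eta>) (tangent_space M x) (tangent_space M x)"

definition norm_H_inverse :: "'a::euclidean_space set \<Rightarrow> 'a \<Rightarrow> 'a \<Rightarrow> ennreal" where
  "norm_H_inverse M x \<eta> =
     (if H_invertible M x \<eta>
      then norm_on (tangent_space M x) (inv_into (tangent_space M x) (H_map M x \<eta>))
      else \<infinity>)"

end

theory Submission
  imports Defs
begin

text \<open>
  Write \<open>T\<close> and \<open>N\<close> for the tangent and normal space of \<open>M\<close> at \<open>x\<close>, and \<open>\<eta> = a - x\<close>. Everything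
  follows from a description of the tangent space of the critical point locus
  (\<open>tangent_space_S_CPP\<close>): a pair \<open>(b, v)\<close> is tangent at \<open>(a, x)\<close> exactly if \<open>v \<in> T\<close> and the
  tangential component of \<open>b\<close> is \<open>H\<^sub>\<eta> v\<close>. On such pairs the derivatives of the two projections are
  \<open>(b, v) \<mapsto> b\<close> and \<open>(b, v) \<mapsto> v\<close>. Hence the first one is invertible iff \<open>H\<^sub>\<eta>\<close> is, and then the
  solution map is \<open>b \<mapsto> H\<^sub>\<eta>\<^sup>-\<^sup>1 (P b)\<close> with \<open>P\<close> the orthogonal projection onto \<open>T\<close>. Composing with \<open>P\<close>
  does not change the norm, as \<open>P\<close> does not increase lengths and is the identity on \<open>T\<close>.

  A curve in the locus consists of a curve \<open>c\<close> in \<open>M\<close> and a normal vector \<open>n(t)\<close> at \<open>c(t)\<close>, via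
  \<open>t \<mapsto> (c(t) + n(t), c(t))\<close>. Differentiating \<open>n \<bullet> W = 0\<close> for tangent fields \<open>W\<close> shows that the
  tangential component of \<open>n'(0)\<close> is \<open>- S\<^sub>\<eta> (c'(0))\<close> where \<open>\<eta> = n(0)\<close> (\<open>weingarten_equation\<close>), which
  gives the necessary condition. For the converse, normal fields are needed whose derivative has a prescribed normal
  component. In a chart \<open>\<phi>\<close> that straightens \<open>M\<close> to a subspace \<open>L\<close>, the maps
  \<open>y \<mapsto> (D\<phi> y)\<^sup>T \<xi>\<close> with \<open>\<xi> \<in> L\<^sup>\<bottom>\<close> are smooth normal fields attaining every normal vector, and
  one takes \<open>\<xi> + t \<zeta>\<close> in place of \<open>\<xi>\<close>. The same fields show that the second fundamental form and the
  Weingarten map, given as definite descriptions, are well defined.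
\<close>

section \<open>Calculus of smooth maps\<close>

text \<open>
  On an open set derivatives depend only on the values there, so functions need to agree only on \<open>U\<close>.
\<close>

lemma Ck_on_cong:
  assumes "open U" "Ck_on k U f" "\<And>x. x \<in> U \<Longrightarrow> f x = g x"
  shows "Ck_on k U g"
  using assms(2,3)
proof (induction k arbitrary: f g)
  case 0
  then show ?case by (simp cong: continuous_on_cong)
next
  case (Suc k)
  have d: "(g has_derivative frechet_derivative f (at x)) (at x)" if "x \<in> U" for x
  proof (rule has_derivative_transform_within_open[OF _ \<open>open U\<close> that])
    have "f differentiable (at x)" using Suc.prems(1) that by simp
    then show "(f has_derivative frechet_derivative f (at x)) (at x)"
      by (simp only: frechet_derivative_works)
  qed (rule Suc.prems(2))
  then have eq: "frechet_derivative f (at x) = frechet_derivative g (at x)" if "x \<in> U" for x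
    using that frechet_derivative_at by blast
  have "Ck_on k U (\<lambda>x. frechet_derivative g (at x) v)" for v
  proof (rule Suc.IH)
    show "Ck_on k U (\<lambda>x. frechet_derivative f (at x) v)" using Suc.prems(1) by simp
  qed (simp add: eq)
  then show ?case
    using d unfolding Ck_on.simps differentiable_def by blast
qed

text \<open>
  The form in which higher smoothness is established below: any explicit formula \<open>f'\<close> for the
  derivative may replace the chosen one.
\<close>

lemma Ck_on_SucI:
  assumes "open U" "\<And>x. x \<in> U \<Longrightarrow> (f has_derivative f' x) (at x)"
    and "\<And>v. Ck_on k U (\<lambda>x. f' x v)"
  shows "Ck_on (Suc k) U f"
proof -
  have "f' x = frechet_derivative f (at x)" if "x \<in> U" for x
    using frechet_derivative_at[OF assms(2)[OF that]] .
  then have "Ck_on k U (\<lambda>x. frechet_derivative f (at x) v)" for v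
    by (intro Ck_on_cong[OF assms(1) assms(3)[of v]]) simp
  moreover have "f differentiable (at x)" if "x \<in> U" for x
    using assms(2)[OF that] unfolding differentiable_def by blast
  ultimately show ?thesis by simp
qed

lemma Ck_on_Suc_has_derivative:
  assumes "Ck_on (Suc k) U f" "x \<in> U"
  shows "(f has_derivative frechet_derivative f (at x)) (at x)"
proof -
  have "f differentiable (at x)" using assms by simp
  then show ?thesis by (simp only: frechet_derivative_works)
qed

lemma Ck_on_Suc_directional:
  "Ck_on (Suc k) U f \<Longrightarrow> Ck_on k U (\<lambda>x. frechet_derivative f (at x) v)"
  by simp

lemma Ck_on_SucD: "Ck_on (Suc k) U f \<Longrightarrow> Ck_on k U f"
proof (induction k arbitrary: f)
  case 0
  then show ?case
    unfolding Ck_on.simps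
    by (intro continuous_at_imp_continuous_on ballI differentiable_imp_continuous_within) blast
next
  case (Suc k)
  show ?case
    unfolding Ck_on.simps(2)[of k]
    using Suc.IH[OF Ck_on_Suc_directional[OF Suc.prems]] Suc.prems by simp
qed

lemma Ck_on_subset: "Ck_on k U f \<Longrightarrow> U' \<subseteq> U \<Longrightarrow> Ck_on k U' f"
  by (induction k arbitrary: f) (auto intro: continuous_on_subset)

lemma Ck_on_const:
  assumes "open U"
  shows "Ck_on k U (\<lambda>x. c)"
proof (induction k arbitrary: c)
  case (Suc k)
  show ?case by (rule Ck_on_SucI[where f' = "\<lambda>x v. 0"]) (rule assms has_derivative_const Suc.IH)+
qed simp

lemma Ck_on_bounded_linear_comp:
  assumes "open U" "bounded_linear h" "Ck_on k U f"
  shows "Ck_on k U (\<lambda>x. h (f x))"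
  using assms(3)
proof (induction k arbitrary: f)
  case 0
  then show ?case
    using assms(2) by (auto intro: bounded_linear.continuous_on)
next
  case (Suc k)
  show ?case
    by (rule Ck_on_SucI[where f' = "\<lambda>x v. h (frechet_derivative f (at x) v)"])
      (rule assms(1) bounded_linear.has_derivative[OF assms(2)] Suc.IH
        Ck_on_Suc_has_derivative[OF Suc.prems] Ck_on_Suc_directional[OF Suc.prems] | assumption)+
qed

lemma Ck_on_bounded_linear:
  assumes "open U" "bounded_linear h"
  shows "Ck_on k U h"
proof (cases k)
  case 0
  then show ?thesis using assms by (simp add: linear_continuous_on)
next
  case (Suc j)
  show ?thesis
    unfolding Suc by (rule Ck_on_SucI[where f' = "\<lambda>x. h"])
      (rule assms Ck_on_const bounded_linear_imp_has_derivative)+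
qed

lemma Ck_on_add:
  assumes "open U" "Ck_on k U f" "Ck_on k U g"
  shows "Ck_on k U (\<lambda>x. f x + g x)"
  using assms(2,3)
proof (induction k arbitrary: f g)
  case 0
  then show ?case by (auto intro: continuous_intros)
next
  case (Suc k)
  show ?case
    by (rule Ck_on_SucI[where f' = "\<lambda>x v. frechet_derivative f (at x) v + frechet_derivative g (at x) v"])
      (rule assms(1) has_derivative_add Suc.IH Suc.prems[THEN Ck_on_Suc_has_derivative]
        Suc.prems[THEN Ck_on_Suc_directional] | assumption)+
qed

lemma Ck_on_sum:
  assumes "open U" "finite I" "\<And>i. i \<in> I \<Longrightarrow> Ck_on k U (f i)"
  shows "Ck_on k U (\<lambda>x. \<Sum>i\<in>I. f i x)"
  using assms(2,3)
  by (induction I rule: finite_induct) (auto intro: Ck_on_add Ck_on_const assms(1))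

lemma Ck_on_bilinear:
  fixes prod :: "'b::euclidean_space \<Rightarrow> 'c::euclidean_space \<Rightarrow> 'd::euclidean_space"
  assumes "open U" "bounded_bilinear prod" "Ck_on k U f" "Ck_on k U g"
  shows "Ck_on k U (\<lambda>x. prod (f x) (g x))"
  using assms(3,4)
proof (induction k arbitrary: f g)
  case 0
  then show ?case using assms(2) by (auto intro: bounded_bilinear.continuous_on)
next
  case (Suc k)
  let ?f' = "\<lambda>x. frechet_derivative f (at x)" and ?g' = "\<lambda>x. frechet_derivative g (at x)"
  show ?case
  proof (rule Ck_on_SucI[where f' = "\<lambda>x v. prod (f x) (?g' x v) + prod (?f' x v) (g x)"])
    show "((\<lambda>x. prod (f x) (g x)) has_derivative
        (\<lambda>v. prod (f x) (?g' x v) + prod (?f' x v) (g x))) (at x)" if "x \<in> U" for x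
      by (rule bounded_bilinear.FDERIV[OF assms(2) Suc.prems[THEN Ck_on_Suc_has_derivative]])
        (rule that)+
    show "Ck_on k U (\<lambda>x. prod (f x) (?g' x v) + prod (?f' x v) (g x))" for v
      by (rule Ck_on_add)
        (rule assms(1) Suc.IH Suc.prems[THEN Ck_on_SucD] Suc.prems[THEN Ck_on_Suc_directional])+
  qed (rule assms(1))
qed

text \<open>
  The chain rule writes a directional derivative of \<open>g \<circ> f\<close> in coordinates, as a sum of products of
  directional derivatives of \<open>f\<close> with compositions \<open>(\<partial>\<^sub>b g) \<circ> f\<close>; both factors are one degree
  less smooth, so induction applies to them.
\<close>

lemma Ck_on_compose:
  fixes f :: "'a::euclidean_space \<Rightarrow> 'b::euclidean_space"
    and g :: "'b \<Rightarrow> 'c::euclidean_space"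
  assumes "open U" "Ck_on k U f" "Ck_on k V g" "f ` U \<subseteq> V"
  shows "Ck_on k U (\<lambda>x. g (f x))"
  using assms(2,3)
proof (induction k arbitrary: g)
  case 0
  then show ?case using assms(4) by (auto intro: continuous_on_compose2)
next
  case (Suc k)
  let ?f' = "\<lambda>x. frechet_derivative f (at x)" and ?g' = "\<lambda>y. frechet_derivative g (at y)"
  have expand: "?g' (f x) (?f' x v) = (\<Sum>b\<in>Basis. (?f' x v \<bullet> b) *\<^sub>R ?g' (f x) b)"
    if "x \<in> U" for x v
  proof -
    have "linear (?g' (f x))"
      using Ck_on_Suc_has_derivative[OF Suc.prems(2)] assms(4) that has_derivative_linear by blast
    from linear_sum[OF this, of "\<lambda>b. (?f' x v \<bullet> b) *\<^sub>R b" Basis] show ?thesis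
      by (simp add: euclidean_representation linear_cmul[OF \<open>linear (?g' (f x))\<close>])
  qed
  show ?case
  proof (rule Ck_on_SucI[where f' = "\<lambda>x v. ?g' (f x) (?f' x v)"])
    show "((\<lambda>x. g (f x)) has_derivative (\<lambda>v. ?g' (f x) (?f' x v))) (at x)" if "x \<in> U" for x
      by (rule has_derivative_compose[OF Ck_on_Suc_has_derivative[OF Suc.prems(1) that]
            Ck_on_Suc_has_derivative[OF Suc.prems(2)]]) (use assms(4) that in blast)
    have "Ck_on k U (\<lambda>x. \<Sum>b\<in>Basis. (?f' x v \<bullet> b) *\<^sub>R ?g' (f x) b)" for v
    proof (rule Ck_on_sum[OF assms(1)])
      fix b :: 'b
      have "Ck_on k U (\<lambda>x. ?f' x v \<bullet> b)"
        by (rule Ck_on_bounded_linear_comp[OF assms(1) bounded_linear_inner_left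
              Ck_on_Suc_directional[OF Suc.prems(1)]])
      moreover have "Ck_on k U (\<lambda>x. ?g' (f x) b)"
        by (rule Suc.IH[OF Ck_on_SucD[OF Suc.prems(1)] Ck_on_Suc_directional[OF Suc.prems(2)]])
      ultimately show "Ck_on k U (\<lambda>x. (?f' x v \<bullet> b) *\<^sub>R ?g' (f x) b)"
        by (rule Ck_on_bilinear[OF assms(1) bounded_bilinear_scaleR])
    qed (rule finite_Basis)
    then show "Ck_on k U (\<lambda>x. ?g' (f x) (?f' x v))" for v
      by (rule Ck_on_cong[OF assms(1)]) (rule expand[symmetric])
  qed (rule assms(1))
qed

lemma smooth_on_subset: "smooth_on U f \<Longrightarrow> U' \<subseteq> U \<Longrightarrow> smooth_on U' f"
  by (auto simp: smooth_on_def intro: Ck_on_subset)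

lemma smooth_on_bounded_linear: "open U \<Longrightarrow> bounded_linear h \<Longrightarrow> smooth_on U h"
  by (simp add: smooth_on_def Ck_on_bounded_linear)

lemma smooth_on_const: "open U \<Longrightarrow> smooth_on U (\<lambda>x. c)"
  by (simp add: smooth_on_def Ck_on_const)

lemma smooth_on_bounded_linear_comp:
  "open U \<Longrightarrow> bounded_linear h \<Longrightarrow> smooth_on U f \<Longrightarrow> smooth_on U (\<lambda>x. h (f x))"
  by (simp add: smooth_on_def Ck_on_bounded_linear_comp)

lemma smooth_on_add:
  "open U \<Longrightarrow> smooth_on U f \<Longrightarrow> smooth_on U g \<Longrightarrow> smooth_on U (\<lambda>x. f x + g x)"
  by (simp add: smooth_on_def Ck_on_add)

lemma smooth_on_sum:
  "open U \<Longrightarrow> finite I \<Longrightarrow> (\<And>i. i \<in> I \<Longrightarrow> smooth_on U (f i)) \<Longrightarrow> smooth_on U (\<lambda>x. \<Sum>i\<in>I. f i x)"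
  by (simp add: smooth_on_def Ck_on_sum)

lemma smooth_on_scaleR:
  "open U \<Longrightarrow> smooth_on U f \<Longrightarrow> smooth_on U g \<Longrightarrow> smooth_on U (\<lambda>x. f x *\<^sub>R g x)"
  by (simp add: smooth_on_def Ck_on_bilinear[OF _ bounded_bilinear_scaleR])

lemma smooth_on_compose:
  "open U \<Longrightarrow> smooth_on U f \<Longrightarrow> smooth_on V g \<Longrightarrow> f ` U \<subseteq> V \<Longrightarrow> smooth_on U (\<lambda>x. g (f x))"
  unfolding smooth_on_def using Ck_on_compose by blast

lemma smooth_on_Pair:
  assumes "open U" "smooth_on U f" "smooth_on U g"
  shows "smooth_on U (\<lambda>x. (f x, g x))"
proof -
  have "smooth_on U (\<lambda>x. (f x, 0) + (0, g x))"
    using assms by (intro smooth_on_add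
        smooth_on_bounded_linear_comp[where h = "\<lambda>y. (y, 0)"]
        smooth_on_bounded_linear_comp[where h = "\<lambda>y. (0, y)"])
      (auto intro: bounded_linear_Pair bounded_linear_ident bounded_linear_zero)
  then show ?thesis by simp
qed

lemma smooth_on_frechet_derivative:
  "smooth_on U f \<Longrightarrow> smooth_on U (\<lambda>x. frechet_derivative f (at x) v)"
  by (metis Ck_on.simps(2) smooth_on_def)

lemma smooth_on_has_derivative:
  "smooth_on U f \<Longrightarrow> x \<in> U \<Longrightarrow> (f has_derivative frechet_derivative f (at x)) (at x)"
  using Ck_on_Suc_has_derivative smooth_on_def by blast

lemma has_vector_derivative_compose:
  assumes "(c has_vector_derivative v) (at t)" "(F has_derivative F') (at (c t))"
  shows "((\<lambda>s. F (c s)) has_vector_derivative F' v) (at t)"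
  using has_derivative_compose[OF assms(1)[unfolded has_vector_derivative_def] assms(2)]
  by (simp add: has_vector_derivative_def linear_cmul[OF has_derivative_linear[OF assms(2)]])

text \<open>
  Pairing \<open>c\<close> with a vector orthogonal to \<open>L\<close> gives a function that vanishes near \<open>t\<close>, so \<open>v\<close> is
  orthogonal to \<open>L\<^sup>\<bottom>\<close>. The case \<open>L = {0}\<close> says that a locally vanishing function has derivative zero.
\<close>

lemma has_vector_derivative_in_subspace:
  fixes c :: "real \<Rightarrow> 'a::euclidean_space"
  assumes "(c has_vector_derivative v) (at t)" "subspace L" "\<forall>\<^sub>F s in nhds t. c s \<in> L"
  shows "v \<in> L"
proof -
  have "v \<bullet> n = 0" if n: "n \<in> L\<^sup>\<bottom>" for n
  proof -
    have "((\<lambda>s. c s \<bullet> n) has_derivative (\<lambda>h. (h *\<^sub>R v) \<bullet> n)) (at t)"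
      using bounded_linear.has_derivative[OF bounded_linear_inner_left] assms(1)
      unfolding has_vector_derivative_def by blast
    moreover have "c s \<bullet> n = 0" if "c s \<in> L" for s
      using that n by (auto simp: orthogonal_comp_def orthogonal_def)
    then have "\<forall>\<^sub>F s in nhds t. c s \<bullet> n = 0"
      using assms(3) by (auto elim: eventually_mono)
    ultimately have "((\<lambda>s. 0) has_derivative (\<lambda>h. (h *\<^sub>R v) \<bullet> n)) (at t)"
      using has_derivative_transform_eventually[of "\<lambda>s. c s \<bullet> n" _ t UNIV "\<lambda>s. 0"]
      by (simp add: eventually_nhds_conv_at)
    then have "(\<lambda>h. (h *\<^sub>R v) \<bullet> n) = (\<lambda>h. 0)"
      using has_derivative_unique has_derivative_const by blast
    from fun_cong[OF this, of 1] show ?thesis by simp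
  qed
  then have "v \<in> L\<^sup>\<bottom>\<^sup>\<bottom>" by (simp add: orthogonal_comp_def orthogonal_def inner_commute)
  then show ?thesis using assms(2) by (simp add: orthogonal_comp_self)
qed

section \<open>Curves and tangent vectors\<close>

text \<open>
  By the chain rule every curve with velocity \<open>v\<close> yields the same value, the ambient derivative; the
  description in \<open>mderiv\<close> is unique because a tangent vector comes with at least one curve.
\<close>

lemma mderiv_eq:
  assumes "v \<in> tangent_space M p" "(F has_derivative F') (at p)"
  shows "mderiv M F p v = F' v"
proof -
  have d: "((F \<circ> c) has_vector_derivative F' v) (at 0)" if "smooth_curve_through M p v c" for c
    using has_vector_derivative_compose[of c v 0 F F'] that assms(2)
    by (auto simp: smooth_curve_through_def o_def)
  obtain c where c: "smooth_curve_through M p v c"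
    using assms(1) by (auto simp: tangent_space_def)
  show ?thesis
    unfolding mderiv_def
  proof (rule the_equality)
    fix w assume "\<forall>c. smooth_curve_through M p v c \<longrightarrow> ((F \<circ> c) has_vector_derivative w) (at 0)"
    then show "w = F' v" using c d vector_derivative_unique_at by blast
  qed (use d in blast)
qed

lemma tangent_space_UNIV: "tangent_space UNIV p = (UNIV :: 'a::euclidean_space set)"
proof -
  have "smooth_curve_through UNIV p v (\<lambda>t. p + t *\<^sub>R v)" for v :: 'a
    unfolding smooth_curve_through_def
  proof (intro conjI exI[of _ 1])
    show "smooth_on {-1<..<1} (\<lambda>t. p + t *\<^sub>R v)"
      by (intro smooth_on_add smooth_on_const smooth_on_bounded_linear bounded_linear_scaleR_left) auto
    show "((\<lambda>t. p + t *\<^sub>R v) has_vector_derivative v) (at 0)"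
      by (auto intro!: derivative_eq_intros simp: has_vector_derivative_def)
  qed auto
  then show ?thesis by (auto simp: tangent_space_def)
qed

lemma smooth_curve_through_eventually:
  assumes "smooth_curve_through M p v c" "open U" "p \<in> U"
  shows "\<forall>\<^sub>F t in nhds 0. c t \<in> U \<inter> M"
proof -
  obtain e where "e > 0" "c ` {-e<..<e} \<subseteq> M" and c: "c 0 = p" "(c has_vector_derivative v) (at 0)"
    using assms(1) by (auto simp: smooth_curve_through_def)
  then have "\<forall>\<^sub>F t in nhds 0. c t \<in> M"
    using eventually_nhds_in_open[of "{-e<..<e}" 0] by (auto elim!: eventually_mono)
  moreover have "\<forall>\<^sub>F t in nhds 0. c t \<in> U"
  proof -
    have "isCont c 0" using c(2) has_vector_derivative_continuous by blast
    then have "(c \<longlongrightarrow> c 0) (nhds 0)" by (simp add: isCont_def tendsto_at_iff_tendsto_nhds)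
    then show ?thesis using assms(2,3) c(1) by (auto simp: tendsto_def)
  qed
  ultimately show ?thesis by eventually_elim auto
qed

lemma smooth_curve_through_restrict:
  assumes "smooth_curve_through M p v c" "open U" "p \<in> U"
  obtains e where "e > 0" "smooth_on {-e<..<e} c" "c ` {-e<..<e} \<subseteq> U \<inter> M"
proof -
  obtain e where e: "e > 0" "smooth_on {-e<..<e} c"
    using assms(1) by (auto simp: smooth_curve_through_def)
  obtain d where d: "d > 0" "\<And>t. \<bar>t\<bar> < d \<Longrightarrow> c t \<in> U \<inter> M"
    using smooth_curve_through_eventually[OF assms] by (auto simp: eventually_nhds_metric)
  show ?thesis
  proof (rule that[of "min d e"])
    show "smooth_on {- min d e<..<min d e} c" by (rule smooth_on_subset[OF e(2)]) auto
    show "c ` {- min d e<..<min d e} \<subseteq> U \<inter> M" using d(2) by auto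
  qed (use d e in auto)
qed

lemma orthogonal_comp_iff: "n \<in> T\<^sup>\<bottom> \<longleftrightarrow> (\<forall>w\<in>T. n \<bullet> w = 0)"
  by (simp add: orthogonal_comp_def orthogonal_def inner_commute)

lemma normal_space_inner: "n \<in> normal_space M y \<Longrightarrow> w \<in> tangent_space M y \<Longrightarrow> n \<bullet> w = 0"
  by (simp add: normal_space_def orthogonal_comp_iff)

lemma normal_spaceI: "(\<And>w. w \<in> tangent_space M y \<Longrightarrow> n \<bullet> w = 0) \<Longrightarrow> n \<in> normal_space M y"
  by (simp add: normal_space_def orthogonal_comp_iff)

section \<open>Tangent and normal spaces in a slice chart\<close>

locale slice_chart =
  fixes M U V :: "'a::euclidean_space set" and \<phi> \<psi> :: "'a \<Rightarrow> 'a" and L :: "'a set"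
  assumes open_U: "open U" and open_V: "open V" and homeo: "homeomorphism U V \<phi> \<psi>"
    and smooth_\<phi>: "smooth_on U \<phi>" and smooth_\<psi>: "smooth_on V \<psi>"
    and subspace_L: "subspace L" and image_\<phi>: "\<phi> ` (U \<inter> M) = V \<inter> L"
begin

abbreviation D\<phi> :: "'a \<Rightarrow> 'a \<Rightarrow> 'a" where "D\<phi> y \<equiv> frechet_derivative \<phi> (at y)"
abbreviation D\<psi> :: "'a \<Rightarrow> 'a \<Rightarrow> 'a" where "D\<psi> y \<equiv> frechet_derivative \<psi> (at (\<phi> y))"

lemma \<phi>_in_V: "y \<in> U \<Longrightarrow> \<phi> y \<in> V"
  and \<psi>_\<phi>: "y \<in> U \<Longrightarrow> \<psi> (\<phi> y) = y"
  using homeo by (auto simp: homeomorphism_def)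

lemma \<psi>_in_M: "z \<in> V \<inter> L \<Longrightarrow> \<psi> z \<in> M"
  using image_\<phi> \<psi>_\<phi> by (metis IntD2 Int_commute imageE IntE)

lemma D\<phi>: "y \<in> U \<Longrightarrow> (\<phi> has_derivative D\<phi> y) (at y)"
  and D\<psi>: "y \<in> U \<Longrightarrow> (\<psi> has_derivative D\<psi> y) (at (\<phi> y))"
  using smooth_on_has_derivative smooth_\<phi> smooth_\<psi> \<phi>_in_V by blast+

lemma linear_D\<phi>: "y \<in> U \<Longrightarrow> linear (D\<phi> y)"
  and linear_D\<psi>: "y \<in> U \<Longrightarrow> linear (D\<psi> y)"
  using D\<phi> D\<psi> has_derivative_linear by blast+

lemma D\<psi>_D\<phi>:
  assumes "y \<in> U"
  shows "D\<psi> y (D\<phi> y v) = v"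
proof -
  have "((\<lambda>y. \<psi> (\<phi> y)) has_derivative (\<lambda>v. D\<psi> y (D\<phi> y v))) (at y)"
    using has_derivative_compose[OF D\<phi> D\<psi>] assms by blast
  moreover have "((\<lambda>y. \<psi> (\<phi> y)) has_derivative (\<lambda>v. v)) (at y)"
    by (rule has_derivative_transform_within_open[OF has_derivative_ident open_U assms])
      (simp add: \<psi>_\<phi>)
  ultimately show ?thesis by (metis has_derivative_unique)
qed

lemma D\<phi>_D\<psi>:
  assumes "y \<in> U"
  shows "D\<phi> y (D\<psi> y v) = v"
proof -
  have "inj (D\<phi> y)" by (metis D\<psi>_D\<phi> assms injI)
  then have "surj (D\<phi> y)" using linear_D\<phi>[OF assms] linear_inj_imp_surj by blast
  then show ?thesis by (metis D\<psi>_D\<phi> assms surjD)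
qed

text \<open>
  The chart carries curves in \<open>M\<close> to curves in \<open>L\<close>, whose velocities stay in \<open>L\<close>; conversely \<open>\<psi>\<close>
  carries a short segment in direction \<open>l \<in> L\<close> to a curve in \<open>M\<close> with velocity \<open>D\<psi> l\<close>. In particular
  the set of velocities of curves is a subspace.
\<close>

lemma tangent_space_eq:
  assumes "y \<in> U \<inter> M"
  shows "tangent_space M y = D\<psi> y ` L"
proof (rule set_eqI, rule iffI)
  fix v assume "v \<in> tangent_space M y"
  then obtain c where c: "smooth_curve_through M y v c" by (auto simp: tangent_space_def)
  then have c0: "c 0 = y" "(c has_vector_derivative v) (at 0)"
    by (auto simp: smooth_curve_through_def)
  have "((\<lambda>s. \<phi> (c s)) has_vector_derivative D\<phi> y v) (at 0)"
    by (rule has_vector_derivative_compose) (use c0 D\<phi> assms in auto)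
  moreover have "\<forall>\<^sub>F s in nhds 0. \<phi> (c s) \<in> L"
    using smooth_curve_through_eventually[OF c open_U] assms image_\<phi>
    by (auto elim!: eventually_mono)
  ultimately have "D\<phi> y v \<in> L"
    using has_vector_derivative_in_subspace subspace_L by blast
  then show "v \<in> D\<psi> y ` L" using assms by (metis D\<psi>_D\<phi> IntD1 imageI)
next
  fix v assume "v \<in> D\<psi> y ` L"
  then obtain l where l: "l \<in> L" "v = D\<psi> y l" by blast
  let ?\<gamma> = "\<lambda>t. \<phi> y + t *\<^sub>R l"
  have \<gamma>L: "?\<gamma> t \<in> L" for t
    using assms image_\<phi> l subspace_L by (auto intro!: subspace_add subspace_scale)
  have \<gamma>': "(?\<gamma> has_vector_derivative l) (at 0)"
    by (auto intro!: derivative_eq_intros simp: has_vector_derivative_def)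
  have "open (?\<gamma> -` V)" by (rule open_vimage[OF open_V]) (intro continuous_intros)
  moreover have "0 \<in> ?\<gamma> -` V" using assms \<phi>_in_V by auto
  ultimately obtain e where "e > 0" "ball 0 e \<subseteq> ?\<gamma> -` V"
    by (meson open_contains_ball)
  then have e: "e > 0" "\<And>t. \<bar>t\<bar> < e \<Longrightarrow> ?\<gamma> t \<in> V"
    by (simp_all add: subset_iff)
  have "smooth_curve_through M y v (\<lambda>t. \<psi> (?\<gamma> t))"
    unfolding smooth_curve_through_def
  proof (intro conjI exI[of _ e])
    have "smooth_on {-e<..<e} ?\<gamma>"
      by (rule smooth_on_add[OF _ smooth_on_const smooth_on_bounded_linear[OF _ bounded_linear_scaleR_left]])
        (rule open_greaterThanLessThan)+
    moreover have "?\<gamma> ` {-e<..<e} \<subseteq> V"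
      using e(2) by (simp add: image_subset_iff abs_less_iff)
    ultimately show "smooth_on {-e<..<e} (\<lambda>t. \<psi> (?\<gamma> t))"
      using smooth_on_compose[OF open_greaterThanLessThan _ smooth_\<psi>] by blast
    show "(\<lambda>t. \<psi> (?\<gamma> t)) ` {-e<..<e} \<subseteq> M"
      using e(2) \<gamma>L by (intro image_subsetI \<psi>_in_M) (simp add: abs_less_iff)
    show "((\<lambda>t. \<psi> (?\<gamma> t)) has_vector_derivative v) (at 0)"
      using has_vector_derivative_compose[OF \<gamma>', of \<psi> "D\<psi> y"] D\<psi> assms l(2) by simp
  qed (use e(1) \<psi>_\<phi> assms in simp_all)
  then show "v \<in> tangent_space M y" by (auto simp: tangent_space_def)
qed

lemma subspace_tangent_space: "y \<in> U \<inter> M \<Longrightarrow> subspace (tangent_space M y)"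
  by (auto simp: tangent_space_eq intro!: linear_subspace_image linear_D\<psi> subspace_L)

text \<open>
  A vector \<open>\<xi>\<close> orthogonal to \<open>L\<close> is pulled back by the transposed derivative of the chart.
  As \<open>(D\<phi>)\<^sup>T \<xi> \<bullet> D\<psi> l = \<xi> \<bullet> l\<close>, the result is a normal field, and it is smooth without any
  orthonormalisation or matrix inversion.
\<close>

definition normal_field :: "'a \<Rightarrow> 'a \<Rightarrow> 'a" where
  "normal_field \<xi> y = adjoint (D\<phi> y) \<xi>"

lemma inner_normal_field: "y \<in> U \<Longrightarrow> normal_field \<xi> y \<bullet> h = \<xi> \<bullet> D\<phi> y h"
  unfolding normal_field_def by (metis adjoint_works inner_commute linear_D\<phi>)

lemma smooth_normal_field: "smooth_on U (normal_field \<xi>)"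
proof -
  have eq: "normal_field \<xi> y = (\<Sum>b\<in>Basis. (D\<phi> y b \<bullet> \<xi>) *\<^sub>R b)" if "y \<in> U" for y
    using euclidean_representation[of "normal_field \<xi> y"]
    by (simp add: inner_normal_field that inner_commute[of \<xi>])
  have "smooth_on U (\<lambda>y. \<Sum>b\<in>Basis. (D\<phi> y b \<bullet> \<xi>) *\<^sub>R b)"
    by (intro smooth_on_sum smooth_on_scaleR smooth_on_const
        smooth_on_bounded_linear_comp[OF _ bounded_linear_inner_left]
        smooth_on_frechet_derivative smooth_\<phi> open_U finite_Basis)
  then show ?thesis
    unfolding smooth_on_def using eq Ck_on_cong[OF open_U] by (metis (no_types, lifting))
qed

lemma normal_field_normal:
  assumes "\<xi> \<in> L\<^sup>\<bottom>" "y \<in> U \<inter> M"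
  shows "normal_field \<xi> y \<in> normal_space M y"
  using assms
  by (auto simp: normal_space_def orthogonal_comp_iff tangent_space_eq inner_normal_field D\<phi>_D\<psi>)

text \<open>
  Take \<open>\<xi> = (D\<psi>)\<^sup>T n\<close>: it is orthogonal to \<open>L\<close> because \<open>n\<close> is orthogonal to \<open>D\<psi> L\<close>, and the transposes
  of \<open>D\<phi>\<close> and \<open>D\<psi>\<close> are inverse to each other.
\<close>

lemma normal_space_extend:
  assumes "y \<in> U \<inter> M" "n \<in> normal_space M y"
  obtains \<xi> where "\<xi> \<in> L\<^sup>\<bottom>" "normal_field \<xi> y = n"
proof
  let ?\<xi> = "adjoint (D\<psi> y) n"
  have i: "?\<xi> \<bullet> h = n \<bullet> D\<psi> y h" for h
    using adjoint_works[OF linear_D\<psi>, of y h n] assms(1) by (simp add: inner_commute)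
  show "?\<xi> \<in> L\<^sup>\<bottom>"
    using assms by (auto simp: orthogonal_comp_iff i normal_space_def tangent_space_eq)
  show "normal_field ?\<xi> y = n"
    using assms by - (rule euclidean_eqI, simp add: inner_normal_field i D\<psi>_D\<phi>)
qed

text \<open>
  The extension has constant components in the chart.
\<close>

lemma tangent_space_extend:
  assumes "y \<in> U \<inter> M" "w \<in> tangent_space M y"
  obtains W where "tangent_field_near M y W" "W y = w"
proof
  let ?W = "\<lambda>z. D\<psi> z (D\<phi> y w)"
  have l: "D\<phi> y w \<in> L" using assms by (auto simp: tangent_space_eq D\<phi>_D\<psi>)
  have "smooth_on U ?W"
    by (rule smooth_on_compose[OF open_U smooth_\<phi> smooth_on_frechet_derivative[OF smooth_\<psi>]])
      (use \<phi>_in_V in auto)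
  then show "tangent_field_near M y ?W"
    unfolding tangent_field_near_def using assms open_U l by (auto simp: tangent_space_eq)
  show "?W y = w" using assms D\<psi>_D\<phi> by blast
qed

end

section \<open>The Weingarten map as the derivative of a normal field\<close>

lemma tangent_field_near_has_derivative:
  "tangent_field_near M x W \<Longrightarrow> (W has_derivative frechet_derivative W (at x)) (at x)"
  unfolding tangent_field_near_def using smooth_on_has_derivative by blast

text \<open>
  The basic identity, obtained by differentiating \<open>n(t) \<bullet> W(c(t)) = 0\<close> for a normal field \<open>n\<close> along
  a curve \<open>c\<close> in \<open>M\<close>: it trades the derivative of a tangent field for that of a normal field.
\<close>

lemma normal_along_curve_derivative:
  assumes c: "smooth_curve_through M x v c" and W: "tangent_field_near M x W"
    and n: "(n has_vector_derivative n') (at 0)"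
    and normal: "\<forall>\<^sub>F t in nhds 0. n t \<in> normal_space M (c t)"
  shows "n' \<bullet> W x + n 0 \<bullet> frechet_derivative W (at x) v = 0"
proof -
  have c0: "c 0 = x" "(c has_vector_derivative v) (at 0)"
    using c by (auto simp: smooth_curve_through_def)
  have "((\<lambda>t. W (c t)) has_vector_derivative frechet_derivative W (at x) v) (at 0)"
    using has_vector_derivative_compose[OF c0(2)] tangent_field_near_has_derivative[OF W] c0(1)
    by blast
  with n have d: "((\<lambda>t. n t \<bullet> W (c t)) has_vector_derivative
      n 0 \<bullet> frechet_derivative W (at x) v + n' \<bullet> W (c 0)) (at 0)"
    by (rule bounded_bilinear.has_vector_derivative[OF bounded_bilinear_inner])
  obtain U where U: "open U" "x \<in> U" "\<And>y. y \<in> U \<inter> M \<Longrightarrow> W y \<in> tangent_space M y"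
    using W by (auto simp: tangent_field_near_def)
  have "\<forall>\<^sub>F t in nhds 0. n t \<bullet> W (c t) \<in> {0}"
    using normal smooth_curve_through_eventually[OF c U(1,2)]
    by eventually_elim (auto intro: normal_space_inner U(3))
  with d have "n 0 \<bullet> frechet_derivative W (at x) v + n' \<bullet> W (c 0) \<in> {0}"
    using has_vector_derivative_in_subspace subspace_single_0 by blast
  then show ?thesis using c0(1) by simp
qed

locale slice_chart_at = slice_chart +
  fixes x :: 'a
  assumes x_in: "x \<in> U \<inter> M"
begin

lemma subspace_tangent: "subspace (tangent_space M x)"
  using subspace_tangent_space x_in by blast

lemma tangent_normal_decomposition:
  obtains t n where "t \<in> tangent_space M x" "n \<in> normal_space M x" "z = t + n"
proof -
  obtain t n where "t \<in> span (tangent_space M x)"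
    "\<And>w. w \<in> span (tangent_space M x) \<Longrightarrow> orthogonal n w" "z = t + n"
    using orthogonal_subspace_decomp_exists by blast
  then show ?thesis
    using that[of t n] subspace_tangent by (auto simp: span_eq_iff[THEN iffD2] orthogonal_def intro!: normal_spaceI)
qed

lemma tangent_eqI_normal_diff:
  assumes "t \<in> tangent_space M x" "t' \<in> tangent_space M x" "t - t' \<in> normal_space M x"
  shows "t = t'"
  using normal_space_inner[OF assms(3) subspace_diff[OF subspace_tangent assms(1,2)]] by simp

lemma tangent_if_orthogonal_normal:
  assumes "\<And>n. n \<in> normal_space M x \<Longrightarrow> n \<bullet> z = 0"
  shows "z \<in> tangent_space M x"
proof -
  obtain t n where z: "t \<in> tangent_space M x" "n \<in> normal_space M x" "z = t + n"
    by (rule tangent_normal_decomposition)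
  then have "n \<bullet> n = 0" using assms[of n] normal_space_inner[of n M x t] by (simp add: inner_right_distrib)
  then show ?thesis using z by simp
qed

lemma normal_field_tangent_field:
  assumes "\<xi> \<in> L\<^sup>\<bottom>" "v \<in> tangent_space M x" "tangent_field_near M x W"
  shows "normal_field \<xi> x \<bullet> frechet_derivative W (at x) v
    = - (frechet_derivative (normal_field \<xi>) (at x) v \<bullet> W x)"
proof -
  obtain c where c: "smooth_curve_through M x v c" using assms(2) by (auto simp: tangent_space_def)
  then have c0: "c 0 = x" "(c has_vector_derivative v) (at 0)"
    by (auto simp: smooth_curve_through_def)
  have "((\<lambda>t. normal_field \<xi> (c t)) has_vector_derivative
      frechet_derivative (normal_field \<xi>) (at x) v) (at 0)"
    using has_vector_derivative_compose[OF c0(2)] c0(1) x_in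
      smooth_on_has_derivative[OF smooth_normal_field] by blast
  moreover have "\<forall>\<^sub>F t in nhds 0. normal_field \<xi> (c t) \<in> normal_space M (c t)"
    using smooth_curve_through_eventually[OF c open_U] x_in
    by (auto elim!: eventually_mono intro: normal_field_normal assms(1))
  ultimately show ?thesis
    using normal_along_curve_derivative[OF c assms(3)] c0(1) by fastforce
qed

text \<open>
  Independence of the extension: for two tangent fields with the same value at \<open>x\<close>, the previous
  identity shows that their derivatives along \<open>v\<close> have the same inner product with every normal
  vector, hence differ by a tangent vector.
\<close>

lemma second_fundamental_form:
  assumes v: "v \<in> tangent_space M x" and W: "tangent_field_near M x W"
  shows "second_fundamental_form M x v (W x) \<in> normal_space M x"
    and "frechet_derivative W (at x) v - second_fundamental_form M x v (W x) \<in> tangent_space M x"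
proof -
  let ?D = "\<lambda>W. frechet_derivative W (at x) v"
  let ?P = "\<lambda>u. u \<in> normal_space M x \<and>
    (\<forall>W'. tangent_field_near M x W' \<and> W' x = W x \<longrightarrow> ?D W' - u \<in> tangent_space M x)"
  have indep: "?D W' - ?D W \<in> tangent_space M x"
    if W': "tangent_field_near M x W'" "W' x = W x" for W'
  proof (rule tangent_if_orthogonal_normal)
    fix n assume "n \<in> normal_space M x"
    then obtain \<xi> where "\<xi> \<in> L\<^sup>\<bottom>" "normal_field \<xi> x = n" using normal_space_extend x_in by blast
    then show "n \<bullet> (?D W' - ?D W) = 0"
      using normal_field_tangent_field[OF _ v W] normal_field_tangent_field[OF _ v W'(1)] W'(2)
      by (auto simp: inner_diff_right)
  qed
  obtain t u where tu: "t \<in> tangent_space M x" "u \<in> normal_space M x" "?D W = t + u"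
    by (rule tangent_normal_decomposition)
  have "?P u"
  proof (intro conjI allI impI)
    fix W' assume "tangent_field_near M x W' \<and> W' x = W x"
    then have "(?D W' - ?D W) + t \<in> tangent_space M x"
      using indep tu(1) subspace_add[OF subspace_tangent] by blast
    then show "?D W' - u \<in> tangent_space M x" using tu(3) by simp
  qed (rule tu(2))
  moreover have "u' = u" if "?P u'" for u'
  proof -
    have "?D W - u' \<in> tangent_space M x" "?D W - u \<in> tangent_space M x"
      using that \<open>?P u\<close> W by blast+
    then have "(?D W - u') - (?D W - u) \<in> tangent_space M x"
      by (rule subspace_diff[OF subspace_tangent])
    then have T: "u - u' \<in> tangent_space M x" by simp
    have "u \<bullet> (u - u') = 0" "u' \<bullet> (u - u') = 0" using that tu(2) T normal_space_inner by blast+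
    then have "(u - u') \<bullet> (u - u') = 0" by (simp add: inner_diff_left)
    then show ?thesis by simp
  qed
  ultimately have "?P (second_fundamental_form M x v (W x))"
    unfolding second_fundamental_form_def by (rule theI)
  then show "second_fundamental_form M x v (W x) \<in> normal_space M x"
    "?D W - second_fundamental_form M x v (W x) \<in> tangent_space M x"
    using W by auto
qed

lemma inner_second_fundamental_form:
  assumes "\<eta> \<in> normal_space M x" "v \<in> tangent_space M x" "tangent_field_near M x W"
  shows "second_fundamental_form M x v (W x) \<bullet> \<eta> = \<eta> \<bullet> frechet_derivative W (at x) v"
  using normal_space_inner[OF assms(1) second_fundamental_form(2)[OF assms(2,3)]]
  by (simp add: inner_diff_right inner_commute)

text \<open>
  Extend \<open>\<eta>\<close> to a normal field. Then \<open>II(v, w) \<bullet> \<eta>\<close> is minus the inner product of \<open>w\<close> with the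
  derivative of that field along \<open>v\<close>, so the functional is represented by minus the tangential
  component of this derivative.
\<close>

lemma weingarten:
  assumes \<eta>: "\<eta> \<in> normal_space M x" and v: "v \<in> tangent_space M x"
  shows "weingarten M x \<eta> v \<in> tangent_space M x"
    and "w \<in> tangent_space M x \<Longrightarrow>
      weingarten M x \<eta> v \<bullet> w = second_fundamental_form M x v w \<bullet> \<eta>"
proof -
  let ?P = "\<lambda>s. s \<in> tangent_space M x \<and>
    (\<forall>w\<in>tangent_space M x. s \<bullet> w = second_fundamental_form M x v w \<bullet> \<eta>)"
  obtain \<xi> where \<xi>: "\<xi> \<in> L\<^sup>\<bottom>" "normal_field \<xi> x = \<eta>" using normal_space_extend \<eta> x_in by blast
  have II: "second_fundamental_form M x v w \<bullet> \<eta> =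
      - (frechet_derivative (normal_field \<xi>) (at x) v \<bullet> w)" if w: "w \<in> tangent_space M x" for w
  proof -
    obtain W where W: "tangent_field_near M x W" "W x = w"
      using tangent_space_extend x_in w by blast
    show ?thesis
      using inner_second_fundamental_form[OF \<eta> v W(1)] normal_field_tangent_field[OF \<xi>(1) v W(1)]
      by (simp add: W \<xi>)
  qed
  obtain t n where tn: "t \<in> tangent_space M x" "n \<in> normal_space M x"
    "frechet_derivative (normal_field \<xi>) (at x) v = t + n"
    by (rule tangent_normal_decomposition)
  have "?P (- t)"
    using tn II by (auto simp: inner_add_left normal_space_inner intro: subspace_neg[OF subspace_tangent])
  moreover have "s = - t" if "?P s" for s
  proof (rule tangent_eqI_normal_diff)
    show "s - - t \<in> normal_space M x"
    proof (rule normal_spaceI)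
      fix w assume "w \<in> tangent_space M x"
      then have "s \<bullet> w = - t \<bullet> w" using that \<open>?P (- t)\<close> by metis
      then show "(s - - t) \<bullet> w = 0" unfolding inner_diff_left by simp
    qed
  qed (use that \<open>?P (- t)\<close> in auto)
  ultimately have "?P (weingarten M x \<eta> v)"
    unfolding weingarten_def by (rule theI)
  then show "weingarten M x \<eta> v \<in> tangent_space M x"
    "w \<in> tangent_space M x \<Longrightarrow> weingarten M x \<eta> v \<bullet> w = second_fundamental_form M x v w \<bullet> \<eta>"
    by auto
qed

text \<open>
  Weingarten's equation: the tangential component of the derivative of a normal field is minus the
  shape operator. Only values along one curve enter, which is what a curve in the critical point
  locus provides.
\<close>

lemma weingarten_equation:
  assumes c: "smooth_curve_through M x v c" and \<eta>: "n 0 \<in> normal_space M x"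
    and n: "(n has_vector_derivative n') (at 0)"
    and normal: "\<forall>\<^sub>F t in nhds 0. n t \<in> normal_space M (c t)"
  shows "n' + weingarten M x (n 0) v \<in> normal_space M x"
proof (rule normal_spaceI)
  fix w assume w: "w \<in> tangent_space M x"
  have v: "v \<in> tangent_space M x" using c by (auto simp: tangent_space_def)
  obtain W where W: "tangent_field_near M x W" "W x = w"
    using tangent_space_extend x_in w by blast
  show "(n' + weingarten M x (n 0) v) \<bullet> w = 0"
    using normal_along_curve_derivative[OF c W(1) n normal] weingarten(2)[OF \<eta> v w]
      inner_second_fundamental_form[OF \<eta> v W(1)] W(2)
    by (simp add: inner_add_left)
qed

lemma H_map_tangent:
  "\<eta> \<in> normal_space M x \<Longrightarrow> v \<in> tangent_space M x \<Longrightarrow> H_map M x \<eta> v \<in> tangent_space M x"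
  unfolding H_map_def using weingarten(1) subspace_diff[OF subspace_tangent] by blast

text \<open>
  Weingarten's equation for a constant curve and a constant normal vector.
\<close>

lemma H_map_zero:
  assumes "\<eta> \<in> normal_space M x"
  shows "H_map M x \<eta> 0 = 0"
proof -
  have "((\<lambda>t. \<eta>) has_vector_derivative 0) (at (0::real))" by simp
  moreover have c: "smooth_curve_through M x 0 (\<lambda>t. x)"
    unfolding smooth_curve_through_def using x_in by (auto intro!: exI[of _ 1] smooth_on_const)
  ultimately have "weingarten M x \<eta> 0 \<in> normal_space M x"
    using weingarten_equation[OF c, of "\<lambda>t. \<eta>" 0] assms by simp
  then show ?thesis
    using tangent_eqI_normal_diff[of "weingarten M x \<eta> 0" 0] weingarten(1)[OF assms] subspace_0[OF subspace_tangent]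
    by (simp add: H_map_def)
qed

section \<open>The tangent space of the critical point locus\<close>

text \<open>
  For \<open>\<subseteq>\<close>, Weingarten's equation is applied to \<open>\<alpha> - \<gamma>\<close> for a curve \<open>(\<alpha>, \<gamma>)\<close> in the locus. For \<open>\<supseteq>\<close>,
  a curve \<open>c\<close> in \<open>M\<close> with velocity \<open>v\<close> is lifted to \<open>(c + n, c)\<close> with a normal field \<open>n\<close> along \<open>c\<close>
  satisfying \<open>n(0) = a - x\<close> and \<open>n'(0) = b - v\<close>. Weingarten's equation fixes the tangential component
  of \<open>n'(0)\<close> to the required value, and the normal component can be adjusted freely.
\<close>

lemma tangent_space_S_CPP:
  assumes ax: "(a, x) \<in> S_CPP M"
  shows "tangent_space (S_CPP M) (a, x) =
    {(b, v). v \<in> tangent_space M x \<and> b - H_map M x (a - x) v \<in> normal_space M x}" (is "?TS = ?R")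
proof (rule set_eqI, rule iffI)
  have \<eta>: "a - x \<in> normal_space M x" using ax by (simp add: S_CPP_def)
  fix q assume "q \<in> ?TS"
  then obtain c where c: "smooth_curve_through (S_CPP M) (a, x) q c"
    by (auto simp: tangent_space_def)
  obtain b v where q: "q = (b, v)" by fastforce
  obtain e where e: "e > 0" "smooth_on {-e<..<e} c" "c ` {-e<..<e} \<subseteq> S_CPP M"
    and c0: "c 0 = (a, x)" "(c has_vector_derivative q) (at 0)"
    using c by (auto simp: smooth_curve_through_def)
  let ?\<alpha> = "\<lambda>t. fst (c t)" and ?\<gamma> = "\<lambda>t. snd (c t)"
  have d: "(?\<alpha> has_vector_derivative b) (at 0)" "(?\<gamma> has_vector_derivative v) (at 0)"
    using c0 q bounded_linear.has_vector_derivative[OF bounded_linear_fst c0(2)]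
      bounded_linear.has_vector_derivative[OF bounded_linear_snd c0(2)] by auto
  have "smooth_on {-e<..<e} ?\<gamma>"
    using e by (intro smooth_on_bounded_linear_comp[OF _ bounded_linear_snd]) auto
  moreover have "?\<gamma> ` {-e<..<e} \<subseteq> M" using e(3) by (force simp: S_CPP_def)
  ultimately have \<gamma>: "smooth_curve_through M x v ?\<gamma>"
    unfolding smooth_curve_through_def using e(1) c0(1) d(2) by auto
  have "\<forall>\<^sub>F t in nhds 0. ?\<alpha> t - ?\<gamma> t \<in> normal_space M (?\<gamma> t)"
    using smooth_curve_through_eventually[OF c open_UNIV]
    by (auto elim!: eventually_mono simp: S_CPP_def split_beta)
  from weingarten_equation[OF \<gamma> _ has_vector_derivative_diff[OF d] this] c0(1) \<eta>
  have "b - H_map M x (a - x) v \<in> normal_space M x"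
    by (simp add: H_map_def algebra_simps)
  then show "q \<in> ?R" using \<gamma> q by (auto simp: tangent_space_def)
next
  have \<eta>: "a - x \<in> normal_space M x" using ax by (simp add: S_CPP_def)
  fix q assume "q \<in> ?R"
  then obtain b v where q: "q = (b, v)" and v: "v \<in> tangent_space M x"
    and b: "b - H_map M x (a - x) v \<in> normal_space M x" by auto
  obtain \<xi> where \<xi>: "\<xi> \<in> L\<^sup>\<bottom>" "normal_field \<xi> x = a - x" using normal_space_extend \<eta> x_in by blast
  let ?B = "frechet_derivative (normal_field \<xi>) (at x) v"
  obtain c where c: "smooth_curve_through M x v c" using v by (auto simp: tangent_space_def)
  then have c0: "c 0 = x" "(c has_vector_derivative v) (at 0)"
    by (auto simp: smooth_curve_through_def)
  have nf: "((\<lambda>t. normal_field \<zeta> (c t)) has_vector_derivative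
      frechet_derivative (normal_field \<zeta>) (at x) v) (at 0)" for \<zeta>
    using has_vector_derivative_compose[OF c0(2)] c0(1) x_in
      smooth_on_has_derivative[OF smooth_normal_field] by blast
  obtain e where e: "e > 0" "smooth_on {-e<..<e} c" "c ` {-e<..<e} \<subseteq> U \<inter> M"
    using smooth_curve_through_restrict[OF c open_U] x_in by blast
  have ev: "\<forall>\<^sub>F t in nhds 0. normal_field \<xi> (c t) \<in> normal_space M (c t)"
    using smooth_curve_through_eventually[OF c open_U] x_in
    by (auto elim!: eventually_mono intro: normal_field_normal \<xi>)
  have "?B + weingarten M x (a - x) v \<in> normal_space M x"
    using weingarten_equation[OF c _ nf[of \<xi>] ev] \<xi> c0 \<eta> by simp
  then have "(b - H_map M x (a - x) v) - (?B + weingarten M x (a - x) v) \<in> normal_space M x"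
    using b unfolding normal_space_def by (rule subspace_diff[OF subspace_orthogonal_comp, rotated])
  \<comment> \<open>\<open>\<xi>\<close> alone realises \<open>n'(0) = B\<close>; the error is normal since the shape operator terms cancel.\<close>
  then have "b - v - ?B \<in> normal_space M x" by (simp add: H_map_def algebra_simps)
  then obtain \<zeta> where \<zeta>: "\<zeta> \<in> L\<^sup>\<bottom>" "normal_field \<zeta> x = b - v - ?B"
    using normal_space_extend x_in by blast
  \<comment> \<open>The second summand vanishes at \<open>0\<close> and corrects the derivative there by \<open>b - v - B\<close>.\<close>
  let ?n = "\<lambda>t. normal_field \<xi> (c t) + t *\<^sub>R normal_field \<zeta> (c t)"
  have n': "(?n has_vector_derivative b - v) (at 0)"
    by (rule has_vector_derivative_eq_rhs[OF has_vector_derivative_add[OF nf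
          has_vector_derivative_scaleR[OF DERIV_ident nf]]]) (simp add: c0 \<zeta>)
  have nN: "?n t \<in> normal_space M (c t)" if "c t \<in> U \<inter> M" for t
    using normal_field_normal[OF \<xi>(1) that] normal_field_normal[OF \<zeta>(1) that]
    unfolding normal_space_def
    by (intro subspace_add subspace_scale subspace_orthogonal_comp)
  have "smooth_curve_through (S_CPP M) (a, x) q (\<lambda>t. (c t + ?n t, c t))"
    unfolding smooth_curve_through_def
  proof (intro conjI exI[of _ e])
    have "smooth_on {-e<..<e} (\<lambda>t. normal_field \<zeta>' (c t))" for \<zeta>'
      using smooth_on_compose[OF _ e(2) smooth_normal_field] e(3) by auto
    then show "smooth_on {-e<..<e} (\<lambda>t. (c t + ?n t, c t))"
      using e(2) by (intro smooth_on_Pair smooth_on_add smooth_on_scaleR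
          smooth_on_bounded_linear[OF _ bounded_linear_ident]) auto
    show "(\<lambda>t. (c t + ?n t, c t)) ` {-e<..<e} \<subseteq> S_CPP M"
    proof (rule image_subsetI)
      fix t assume "t \<in> {-e<..<e}"
      then have "c t \<in> U \<inter> M" using e(3) by blast
      then show "(c t + ?n t, c t) \<in> S_CPP M" using nN by (simp add: S_CPP_def)
    qed
    show "((\<lambda>t. (c t + ?n t, c t)) has_vector_derivative q) (at 0)"
      using has_vector_derivative_Pair[OF has_vector_derivative_add[OF c0(2) n'] c0(2)] q by simp
  qed (use e \<xi> c0 in auto)
  then show "q \<in> ?TS" by (auto simp: tangent_space_def)
qed

end

section \<open>The condition number\<close>

lemma embedded_submanifold_slice_chart_at:
  fixes M :: "'a::euclidean_space set"
  assumes "embedded_submanifold M m" "x \<in> M"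
  obtains U V \<phi> \<psi> L where "slice_chart_at M U V \<phi> \<psi> L x"
proof -
  obtain U V \<phi> \<psi> and L :: "'a set" where
    "open U \<and> x \<in> U \<and> open (V :: 'a set) \<and> homeomorphism U V \<phi> \<psi> \<and> smooth_on U \<phi> \<and> smooth_on V \<psi> \<and>
        subspace L \<and> dim L = m \<and> \<phi> ` (U \<inter> M) = V \<inter> L"
    using assms(1)[unfolded embedded_submanifold_def, rule_format, OF assms(2)]
    by (elim exE) (rule that)
  then show ?thesis
    using assms(2) by (intro that[of U V \<phi> \<psi> L]) (unfold_locales, auto)
qed

lemma bij_betw_iff_ex1:
  assumes "\<And>x. x \<in> A \<Longrightarrow> f x \<in> B"
  shows "bij_betw f A B \<longleftrightarrow> (\<forall>b\<in>B. \<exists>!x. x \<in> A \<and> f x = b)" (is "?bij \<longleftrightarrow> ?ex1")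
proof
  assume ?bij
  then show ?ex1 unfolding bij_betw_def inj_on_def by blast
next
  assume R: ?ex1
  have "inj_on f A" using R assms by (intro inj_onI) metis
  moreover have "f ` A = B" using R assms by blast
  ultimately show ?bij by (simp add: bij_betw_def)
qed

lemma bij_betw_fst_iff: "bij_betw fst {(b, v). P b v} UNIV \<longleftrightarrow> (\<forall>b. \<exists>!v. P b v)"
proof -
  have "(\<exists>!q. q \<in> {(b, v). P b v} \<and> fst q = b) \<longleftrightarrow> (\<exists>!v. P b v)" for b
    by (simp add: Ex1_def split_paired_Ex split_paired_All)
  then show ?thesis by (subst bij_betw_iff_ex1) auto
qed

context slice_chart_at
begin

lemma mderiv_projections:
  assumes "q \<in> tangent_space S (a, x)"
  shows "mderiv S fst (a, x) q = fst q" "mderiv S snd (a, x) q = snd q"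
  by (rule mderiv_eq[OF assms bounded_linear_imp_has_derivative[OF bounded_linear_fst]],
      rule mderiv_eq[OF assms bounded_linear_imp_has_derivative[OF bounded_linear_snd]])

text \<open>
  Every \<open>b\<close> splits as \<open>t + n\<close> with \<open>t\<close> tangent and \<open>n\<close> normal, and \<open>(b, v)\<close> is tangent to the locus
  iff \<open>H v = t\<close>. So unique solvability in \<open>v\<close> for all \<open>b\<close> is unique solvability for all tangent \<open>b\<close>.
\<close>

lemma fst_deriv_invertible_iff:
  assumes ax: "(a, x) \<in> S_CPP M"
  shows "fst_deriv_invertible (S_CPP M) (a, x) \<longleftrightarrow> H_invertible M x (a - x)"
proof -
  let ?TS = "tangent_space (S_CPP M) (a, x)" and ?T = "tangent_space M x"
    and ?N = "normal_space M x" and ?H = "H_map M x (a - x)"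
  have \<eta>: "a - x \<in> ?N" using ax by (simp add: S_CPP_def)
  have N0: "0 \<in> ?N" by (simp add: normal_spaceI)
  have "fst_deriv_invertible (S_CPP M) (a, x) \<longleftrightarrow> bij_betw fst ?TS UNIV"
    unfolding fst_deriv_invertible_def tangent_space_UNIV
    by (rule bij_betw_cong) (rule mderiv_projections)
  also have "\<dots> \<longleftrightarrow> (\<forall>b. \<exists>!v. v \<in> ?T \<and> b - ?H v \<in> ?N)"
    unfolding tangent_space_S_CPP[OF ax] by (rule bij_betw_fst_iff)
  also have "\<dots> \<longleftrightarrow> (\<forall>b\<in>?T. \<exists>!v. v \<in> ?T \<and> ?H v = b)" (is "?A \<longleftrightarrow> ?B")
  proof -
    have iff: "b + n - ?H v \<in> ?N \<longleftrightarrow> ?H v = b"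
      if "b \<in> ?T" "n \<in> ?N" "v \<in> ?T" for b n v
    proof
      assume "b + n - ?H v \<in> ?N"
      then have "(b + n - ?H v) - n \<in> ?N"
        using that(2) unfolding normal_space_def
        by (rule subspace_diff[OF subspace_orthogonal_comp])
      then show "?H v = b"
        using tangent_eqI_normal_diff[of b "?H v"] that H_map_tangent[OF \<eta>] by simp
    qed (use that(2) in simp)
    show ?thesis
    proof
      assume A: ?A
      show ?B
      proof
        fix b assume "b \<in> ?T"
        then have "(v \<in> ?T \<and> b - ?H v \<in> ?N) = (v \<in> ?T \<and> ?H v = b)" for v
          using iff[of b 0 v] N0 by (cases "v \<in> ?T") simp_all
        then show "\<exists>!v. v \<in> ?T \<and> ?H v = b" using A[rule_format, of b] by simp
      qed
    next
      assume B: ?B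
      show ?A
      proof
        fix b
        obtain t n where tn: "t \<in> ?T" "n \<in> ?N" "b = t + n" by (rule tangent_normal_decomposition)
        then have "(v \<in> ?T \<and> b - ?H v \<in> ?N) = (v \<in> ?T \<and> ?H v = t)" for v
          using iff[of t n v] by (cases "v \<in> ?T") simp_all
        then show "\<exists>!v. v \<in> ?T \<and> b - ?H v \<in> ?N" using B tn(1) by simp
      qed
    qed
  qed
  also have "\<dots> \<longleftrightarrow> H_invertible M x (a - x)"
    unfolding H_invertible_def by (rule bij_betw_iff_ex1[OF H_map_tangent[OF \<eta>], symmetric])
  finally show ?thesis .
qed

text \<open>
  The solution map \<open>K\<close> sends \<open>t + n\<close> to \<open>H\<^sup>-\<^sup>1 t\<close>. Tangent vectors suffice in the
  supremum that defines its norm: dropping \<open>n\<close> keeps the numerator \<open>K (t + n)\<close> and does not increase the denominator, since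
  \<open>norm t \<le> norm (t + n)\<close> by orthogonality. If \<open>t = 0\<close>, the quotient is zero.
\<close>

lemma condition_number_eq:
  assumes ax: "(a, x) \<in> S_CPP M"
  shows "condition_number (S_CPP M) (a, x) = norm_H_inverse M x (a - x)"
proof (cases "H_invertible M x (a - x)")
  case False
  then show ?thesis
    by (simp add: condition_number_def norm_H_inverse_def fst_deriv_invertible_iff[OF ax])
next
  case True
  let ?S = "S_CPP M" and ?T = "tangent_space M x" and ?N = "normal_space M x"
    and ?H = "H_map M x (a - x)"
  let ?TS = "tangent_space ?S (a, x)"
  define G where "G = inv_into ?T ?H"
  define K where "K = mderiv ?S snd (a, x) \<circ> inv_into ?TS (mderiv ?S fst (a, x))"
  have \<eta>: "a - x \<in> ?N" using ax by (simp add: S_CPP_def)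
  have inv: "fst_deriv_invertible ?S (a, x)" using True ax fst_deriv_invertible_iff by blast
  have bij: "bij_betw ?H ?T ?T" using True by (simp add: H_invertible_def)
  have G: "G t \<in> ?T" "?H (G t) = t" if "t \<in> ?T" for t
    using bij that unfolding G_def
    by (auto simp: bij_betw_def f_inv_into_f intro: inv_into_into)
  have G0: "G 0 = 0"
    using bij H_map_zero[OF \<eta>] subspace_0[OF subspace_tangent] unfolding G_def
    by (metis bij_betw_inv_into_left)
  have K: "K (t + n) = G t" if "t \<in> ?T" "n \<in> ?N" for t n
  proof -
    have q: "(t + n, G t) \<in> ?TS" unfolding tangent_space_S_CPP[OF ax] using that G by simp
    have "inv_into ?TS (mderiv ?S fst (a, x)) (t + n) = (t + n, G t)"
      using bij_betw_inv_into_left[OF inv[unfolded fst_deriv_invertible_def] q]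
        mderiv_projections(1)[OF q] by simp
    then show ?thesis using mderiv_projections(2)[OF q] by (simp add: K_def)
  qed
  have "norm_on UNIV K = norm_on ?T G"
  proof (rule antisym)
    show "norm_on UNIV K \<le> norm_on ?T G"
      unfolding norm_on_def
    proof (rule SUP_least)
      fix b :: 'a assume b: "b \<in> UNIV - {0}"
      obtain t n where tn: "t \<in> ?T" "n \<in> ?N" "b = t + n" by (rule tangent_normal_decomposition)
      show "ennreal (norm (K b) / norm b) \<le> (SUP t\<in>?T - {0}. ennreal (norm (G t) / norm t))"
      proof (cases "t = 0")
        case True
        then show ?thesis using K[OF tn(1,2)] tn(3) G0 by simp
      next
        case False
        have "norm t ^ 2 \<le> norm b ^ 2"
          unfolding tn(3) using normal_space_inner[OF tn(2,1)]
          by (simp add: power2_norm_eq_inner inner_add inner_commute)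
        then have "norm t \<le> norm b" by (simp add: power_mono_iff)
        then have "norm (K b) / norm b \<le> norm (G t) / norm t"
          using False b K[OF tn(1,2)] tn(3) by (simp add: divide_left_mono)
        then show ?thesis
          using False tn(1) by (intro SUP_upper2[of t]) (auto intro: ennreal_leI)
      qed
    qed
    have "K t = G t" if "t \<in> ?T" for t
      using K[OF that, of 0] by (simp add: normal_spaceI)
    then show "norm_on ?T G \<le> norm_on UNIV K"
      unfolding norm_on_def by (intro SUP_subset_mono) auto
  qed
  then show ?thesis
    using True inv
    by (simp add: condition_number_def norm_H_inverse_def tangent_space_UNIV K_def G_def)
qed

end

theorem theorem4p3:
  fixes \<I> :: "(real ^ 'n) set" and m :: nat and a x \<eta> :: "real ^ 'n"
  assumes "embedded_submanifold \<I> m"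
    and "(a, x) \<in> S_CPP \<I>"
    and "\<eta> = a - x"
  shows "condition_number (S_CPP \<I>) (a, x) = norm_H_inverse \<I> x \<eta>
    \<and> ((a, x) \<in> S_CPP \<I> - W_CPP \<I> \<longrightarrow> \<not> H_invertible \<I> x \<eta>)"
proof -
  have "x \<in> \<I>" using assms(2) by (simp add: S_CPP_def)
  with assms(1) obtain U V \<phi> \<psi> L where "slice_chart_at \<I> U V \<phi> \<psi> L x"
    by (rule embedded_submanifold_slice_chart_at)
  then interpret slice_chart_at \<I> U V \<phi> \<psi> L x .
  show ?thesis
    using condition_number_eq[OF assms(2)] fst_deriv_invertible_iff[OF assms(2)] assms(2,3)
    by (auto simp: W_CPP_def)
qed

end
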